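(* A variety of modular bounded lattices is passive structurally complete if and only if it is the variety of bounded distributive lattices.
   Context: Bounded lattices are lattices with two constants $0,1$ interpreted as bottom and top. For a quasivariety $\mathcal Q$ with free algebra $\mathbf F_{\mathcal Q}(\omega)$ on countably many generators: a substitution (homomorphism from terms into $\mathbf F_{\mathcal Q}(\omega)$) unifies a set of equations $\Sigma$ if it identifies both sides of each equation of $\Sigma$; a quasiequation $\Sigma\Rightarrow\delta$ ($\Sigma$ finite) is admissible if every substitution unifying $\Sigma$ unifies $\delta$, and passive if no substitution unifies $\Sigma$; $\mathcal Q$ is passive structurally complete if every passive admissible quasiequation is valid in $\mathcal Q$.
   Formalization: The variety is assumed nontrivial, since the trivial variety is vacuously passive structurally complete but not the variety of bounded distributive lattices; varieties are represented by their members on an arbitrary infinite carrier set, which determines them. *)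

theory Defs
  imports Main
begin

text \<open>
  Algebras of the signature of bounded lattices. Nothing is assumed about the values of the
  operations outside the carrier, and no notion below depends on them.
\<close>

record 'a bl_algebra =
  carrier :: "'a set"
  meet :: "'a \<Rightarrow> 'a \<Rightarrow> 'a"
  join :: "'a \<Rightarrow> 'a \<Rightarrow> 'a"
  bot_el :: 'a
  top_el :: 'a

definition algebra :: "'a bl_algebra \<Rightarrow> bool" where
  "algebra A \<longleftrightarrow>
     bot_el A \<in> carrier A \<and> top_el A \<in> carrier A \<and>
     (\<forall>x\<in>carrier A. \<forall>y\<in>carrier A. meet A x y \<in> carrier A \<and> join A x y \<in> carrier A)"

definition homomorphism :: "'a bl_algebra \<Rightarrow> 'b bl_algebra \<Rightarrow> ('a \<Rightarrow> 'b) \<Rightarrow> bool" where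
  "homomorphism A B h \<longleftrightarrow>
     (\<forall>x\<in>carrier A. h x \<in> carrier B) \<and>
     h (bot_el A) = bot_el B \<and> h (top_el A) = top_el B \<and>
     (\<forall>x\<in>carrier A. \<forall>y\<in>carrier A.
        h (meet A x y) = meet B (h x) (h y) \<and> h (join A x y) = join B (h x) (h y))"

definition bounded_lattice_algebra :: "'a bl_algebra \<Rightarrow> bool" where
  "bounded_lattice_algebra A \<longleftrightarrow> algebra A \<and>
     (\<forall>x\<in>carrier A. \<forall>y\<in>carrier A. \<forall>z\<in>carrier A.
        meet A x (meet A y z) = meet A (meet A x y) z \<and>
        join A x (join A y z) = join A (join A x y) z) \<and>
     (\<forall>x\<in>carrier A. \<forall>y\<in>carrier A.
        meet A x y = meet A y x \<and> join A x y = join A y x \<and>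
        meet A x (join A x y) = x \<and> join A x (meet A x y) = x) \<and>
     (\<forall>x\<in>carrier A. join A (bot_el A) x = x \<and> meet A (top_el A) x = x)"

definition lattice_le :: "'a bl_algebra \<Rightarrow> 'a \<Rightarrow> 'a \<Rightarrow> bool" where
  "lattice_le A x y \<longleftrightarrow> meet A x y = x"

definition modular_bounded_lattice :: "'a bl_algebra \<Rightarrow> bool" where
  "modular_bounded_lattice A \<longleftrightarrow> bounded_lattice_algebra A \<and>
     (\<forall>x\<in>carrier A. \<forall>y\<in>carrier A. \<forall>z\<in>carrier A.
        lattice_le A x z \<longrightarrow> join A x (meet A y z) = meet A (join A x y) z)"

definition distributive_bounded_lattice :: "'a bl_algebra \<Rightarrow> bool" where
  "distributive_bounded_lattice A \<longleftrightarrow> bounded_lattice_algebra A \<and>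
     (\<forall>x\<in>carrier A. \<forall>y\<in>carrier A. \<forall>z\<in>carrier A.
        meet A x (join A y z) = join A (meet A x y) (meet A x z))"

datatype bl_term = Var nat | Bot | Top | Meet bl_term bl_term | Join bl_term bl_term

type_synonym equation = "bl_term \<times> bl_term"

definition term_algebra :: "bl_term bl_algebra" where
  "term_algebra = \<lparr>carrier = UNIV, meet = Meet, join = Join, bot_el = Bot, top_el = Top\<rparr>"

primrec eval :: "'a bl_algebra \<Rightarrow> (nat \<Rightarrow> 'a) \<Rightarrow> bl_term \<Rightarrow> 'a" where
  "eval A v (Var n) = v n"
| "eval A v Bot = bot_el A"
| "eval A v Top = top_el A"
| "eval A v (Meet s t) = meet A (eval A v s) (eval A v t)"
| "eval A v (Join s t) = join A (eval A v s) (eval A v t)"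

definition assignment :: "'a bl_algebra \<Rightarrow> (nat \<Rightarrow> 'a) \<Rightarrow> bool" where
  "assignment A v \<longleftrightarrow> (\<forall>n. v n \<in> carrier A)"

definition satisfied_by :: "'a bl_algebra \<Rightarrow> (nat \<Rightarrow> 'a) \<Rightarrow> equation \<Rightarrow> bool" where
  "satisfied_by A v e \<longleftrightarrow> eval A v (fst e) = eval A v (snd e)"

definition eq_valid :: "'a bl_algebra \<Rightarrow> equation \<Rightarrow> bool" where
  "eq_valid A e \<longleftrightarrow> (\<forall>v. assignment A v \<longrightarrow> satisfied_by A v e)"

text \<open>
  A variety is an equational class. Classes of algebras are represented by their members with
  carrier in the type \<open>'a\<close>; if \<open>'a\<close> is infinite, this loses nothing, because terms are finite
  and there are countably many of them, so that an equation or quasiequation failing in some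
  algebra fails in a countable subalgebra of it.
\<close>

definition variety :: "'a bl_algebra set \<Rightarrow> bool" where
  "variety V \<longleftrightarrow> (\<exists>E. V = {A. algebra A \<and> (\<forall>e\<in>E. eq_valid A e)})"

definition nontrivial :: "'a bl_algebra set \<Rightarrow> bool" where
  "nontrivial V \<longleftrightarrow> (\<exists>A\<in>V. \<exists>x\<in>carrier A. \<exists>y\<in>carrier A. x \<noteq> y)"

text \<open>
  The free algebra on the countably many generators \<open>[Var n]\<close>: the term algebra modulo the
  identities of the class.
\<close>

definition identities :: "'a bl_algebra set \<Rightarrow> equation set" where
  "identities Q = {e. \<forall>A\<in>Q. eq_valid A e}"

definition free_algebra :: "'a bl_algebra set \<Rightarrow> bl_term set bl_algebra" where
  "free_algebra Q =
     \<lparr>carrier = UNIV // identities Q,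
      meet = (\<lambda>X Y. \<Union>s\<in>X. \<Union>t\<in>Y. identities Q `` {Meet s t}),
      join = (\<lambda>X Y. \<Union>s\<in>X. \<Union>t\<in>Y. identities Q `` {Join s t}),
      bot_el = identities Q `` {Bot},
      top_el = identities Q `` {Top}\<rparr>"

definition substitution :: "'a bl_algebra set \<Rightarrow> (bl_term \<Rightarrow> bl_term set) \<Rightarrow> bool" where
  "substitution Q \<sigma> \<longleftrightarrow> homomorphism term_algebra (free_algebra Q) \<sigma>"

definition unifies :: "(bl_term \<Rightarrow> bl_term set) \<Rightarrow> equation set \<Rightarrow> bool" where
  "unifies \<sigma> \<Sigma> \<longleftrightarrow> (\<forall>(s, t)\<in>\<Sigma>. \<sigma> s = \<sigma> t)"

definition admissible_quasieq :: "'a bl_algebra set \<Rightarrow> equation set \<Rightarrow> equation \<Rightarrow> bool" where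
  "admissible_quasieq Q \<Sigma> \<delta> \<longleftrightarrow>
     (\<forall>\<sigma>. substitution Q \<sigma> \<longrightarrow> unifies \<sigma> \<Sigma> \<longrightarrow> unifies \<sigma> {\<delta>})"

definition passive_quasieq :: "'a bl_algebra set \<Rightarrow> equation set \<Rightarrow> equation \<Rightarrow> bool" where
  "passive_quasieq Q \<Sigma> \<delta> \<longleftrightarrow> \<not> (\<exists>\<sigma>. substitution Q \<sigma> \<and> unifies \<sigma> \<Sigma>)"

definition quasieq_valid :: "'a bl_algebra set \<Rightarrow> equation set \<Rightarrow> equation \<Rightarrow> bool" where
  "quasieq_valid Q \<Sigma> \<delta> \<longleftrightarrow>
     (\<forall>A\<in>Q. \<forall>v. assignment A v \<longrightarrow> (\<forall>e\<in>\<Sigma>. satisfied_by A v e) \<longrightarrow> satisfied_by A v \<delta>)"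

definition passive_structurally_complete :: "'a bl_algebra set \<Rightarrow> bool" where
  "passive_structurally_complete Q \<longleftrightarrow>
     (\<forall>\<Sigma> \<delta>. finite \<Sigma> \<longrightarrow> passive_quasieq Q \<Sigma> \<delta> \<longrightarrow> admissible_quasieq Q \<Sigma> \<delta> \<longrightarrow> quasieq_valid Q \<Sigma> \<delta>)"

end

theory Submission
  imports Defs
begin

text \<open>
  Evaluating all variables of the free algebra of a nontrivial variety \<open>V\<close> of bounded lattices at
  bottom maps it onto the two-element lattice, so a set of equations is unifiable in \<open>V\<close> iff it
  has a solution in the two-element lattice. Prime filters map every nontrivial distributive
  lattice onto the two-element lattice; this makes the distributive variety passive structurally
  complete and the least nontrivial variety. Conversely, a nondistributive modular lattice in \<open>V\<close>
  contains a diamond with bounds \<open>p < q\<close>. The interval \<open>[p, q]\<close> lies in \<open>V\<close> again, because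
  adding the old bounds to it gives a subalgebra from which it arises by collapsing the old bounds
  to the new ones. The equations saying that three elements are pairwise complements are solvable
  in the interval but not in the two-element lattice.
\<close>

section \<open>Bounded lattices with a carrier set\<close>

locale bounded_lat =
  fixes A :: "'a bl_algebra"
  assumes bounded_lattice: "bounded_lattice_algebra A"
begin

abbreviation "C \<equiv> carrier A"
abbreviation m (infixl "\<sqinter>" 70) where "x \<sqinter> y \<equiv> meet A x y"
abbreviation j (infixl "\<squnion>" 65) where "x \<squnion> y \<equiv> join A x y"
abbreviation le (infix "\<sqsubseteq>" 50) where "x \<sqsubseteq> y \<equiv> lattice_le A x y"

lemma closed [simp, intro]:
  "bot_el A \<in> C" "top_el A \<in> C"
  "x \<in> C \<Longrightarrow> y \<in> C \<Longrightarrow> x \<sqinter> y \<in> C"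
  "x \<in> C \<Longrightarrow> y \<in> C \<Longrightarrow> x \<squnion> y \<in> C"
  using bounded_lattice by (auto simp: bounded_lattice_algebra_def algebra_def)

lemma eval_closed [simp]: "assignment A v \<Longrightarrow> eval A v t \<in> C"
  by (induction t) (auto simp: assignment_def)

lemma
  assumes "x \<in> C" "y \<in> C"
  shows meet_commute: "x \<sqinter> y = y \<sqinter> x"
    and join_commute: "x \<squnion> y = y \<squnion> x"
    and meet_absorb: "x \<sqinter> (x \<squnion> y) = x"
    and join_absorb: "x \<squnion> (x \<sqinter> y) = x"
  using assms bounded_lattice by (simp_all add: bounded_lattice_algebra_def)

lemma
  assumes "x \<in> C" "y \<in> C" "z \<in> C"
  shows meet_assoc: "x \<sqinter> y \<sqinter> z = x \<sqinter> (y \<sqinter> z)"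
    and join_assoc: "x \<squnion> y \<squnion> z = x \<squnion> (y \<squnion> z)"
  using assms bounded_lattice unfolding bounded_lattice_algebra_def by (blast intro: sym)+

lemma meet_idem [simp]: "x \<in> C \<Longrightarrow> x \<sqinter> x = x"
  using meet_absorb[of x "x \<sqinter> x"] join_absorb[of x x] by simp

lemma join_idem [simp]: "x \<in> C \<Longrightarrow> x \<squnion> x = x"
  using join_absorb[of x x] by simp

lemma bounds_simps [simp]:
  assumes "x \<in> C"
  shows "bot_el A \<squnion> x = x" "x \<squnion> bot_el A = x" "top_el A \<sqinter> x = x" "x \<sqinter> top_el A = x"
    "bot_el A \<sqinter> x = bot_el A" "x \<sqinter> bot_el A = bot_el A"
    "top_el A \<squnion> x = top_el A" "x \<squnion> top_el A = top_el A"
proof -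
  show *: "bot_el A \<squnion> x = x" "top_el A \<sqinter> x = x"
    using assms bounded_lattice unfolding bounded_lattice_algebra_def by blast+
  show "x \<squnion> bot_el A = x" "x \<sqinter> top_el A = x"
    using * meet_commute[of x "top_el A"] join_commute[of x "bot_el A"] assms by simp_all
  show **: "bot_el A \<sqinter> x = bot_el A" "top_el A \<squnion> x = top_el A"
    using * meet_absorb[of "bot_el A" x] join_absorb[of "top_el A" x] assms by simp_all
  show "x \<sqinter> bot_el A = bot_el A" "x \<squnion> top_el A = top_el A"
    using ** meet_commute[of x "bot_el A"] join_commute[of x "top_el A"] assms by simp_all
qed

lemma le_refl [simp]: "x \<in> C \<Longrightarrow> x \<sqsubseteq> x"
  by (simp add: lattice_le_def)

lemma le_antisym: "x \<in> C \<Longrightarrow> y \<in> C \<Longrightarrow> x \<sqsubseteq> y \<Longrightarrow> y \<sqsubseteq> x \<Longrightarrow> x = y"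
  using meet_commute[of x y] by (simp add: lattice_le_def)

lemma le_trans: "x \<in> C \<Longrightarrow> y \<in> C \<Longrightarrow> z \<in> C \<Longrightarrow> x \<sqsubseteq> y \<Longrightarrow> y \<sqsubseteq> z \<Longrightarrow> x \<sqsubseteq> z"
  using meet_assoc[of x y z] by (simp add: lattice_le_def)

lemma le_iff_join: "x \<in> C \<Longrightarrow> y \<in> C \<Longrightarrow> x \<sqsubseteq> y \<longleftrightarrow> x \<squnion> y = y"
  using meet_absorb[of x y] join_absorb[of y x] meet_commute[of x y] join_commute[of x y]
  by (auto simp: lattice_le_def)

lemma meet_le [simp]:
  assumes "x \<in> C" "y \<in> C"
  shows "x \<sqinter> y \<sqsubseteq> x" "x \<sqinter> y \<sqsubseteq> y"
  using assms meet_assoc[of x y y] meet_assoc[of x x y] meet_assoc[of x y x] meet_commute[of x y]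
  by (simp_all add: lattice_le_def)

lemma le_join [simp]:
  assumes "x \<in> C" "y \<in> C"
  shows "x \<sqsubseteq> x \<squnion> y" "y \<sqsubseteq> x \<squnion> y"
  using assms meet_absorb[of x y] meet_absorb[of y x] join_commute[of x y]
  by (simp_all add: lattice_le_def)

lemma le_meet_iff [simp]:
  "x \<in> C \<Longrightarrow> y \<in> C \<Longrightarrow> z \<in> C \<Longrightarrow> z \<sqsubseteq> x \<sqinter> y \<longleftrightarrow> z \<sqsubseteq> x \<and> z \<sqsubseteq> y"
  using le_trans[of z "x \<sqinter> y" x] le_trans[of z "x \<sqinter> y" y] meet_assoc[of z x y]
  by (auto simp: lattice_le_def[of A z])

lemma join_le_iff [simp]:
  "x \<in> C \<Longrightarrow> y \<in> C \<Longrightarrow> z \<in> C \<Longrightarrow> x \<squnion> y \<sqsubseteq> z \<longleftrightarrow> x \<sqsubseteq> z \<and> y \<sqsubseteq> z"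
  using le_trans[of x "x \<squnion> y" z] le_trans[of y "x \<squnion> y" z] join_assoc[of x y z]
  by (auto simp: le_iff_join[of _ z])

lemma meet_le_trans:
  assumes "x \<in> C" "y \<in> C" "z \<in> C" "x \<sqsubseteq> z \<or> y \<sqsubseteq> z"
  shows "x \<sqinter> y \<sqsubseteq> z"
  using assms by (meson closed(3) le_trans meet_le)

lemma le_join_trans:
  assumes "x \<in> C" "y \<in> C" "z \<in> C" "z \<sqsubseteq> x \<or> z \<sqsubseteq> y"
  shows "z \<sqsubseteq> x \<squnion> y"
  using assms by (meson closed(4) le_trans le_join)

text \<open>The new bounds keep the interval from being a subalgebra in general. Identities still
  pass to it, because it is a homomorphic image of a subalgebra of \<open>A\<close>.\<close>

lemma eq_valid_interval:
  assumes pq: "p \<in> C" "q \<in> C" "p \<sqsubseteq> q" "p \<noteq> q"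
    and e: "eq_valid A e"
  shows "eq_valid (A\<lparr>carrier := {x \<in> C. p \<sqsubseteq> x \<and> x \<sqsubseteq> q}, bot_el := p, top_el := q\<rparr>) e"
    (is "eq_valid ?B e")
  unfolding eq_valid_def
proof (intro allI impI)
  fix v assume v: "assignment ?B v"
  define S where "S = {x \<in> C. p \<sqsubseteq> x \<and> x \<sqsubseteq> q}"
  \<comment> \<open>The graph of the map that collapses the old bounds to \<open>p\<close> and
    \<open>q\<close>. As a relation it respects the operations without a decision whether an old
    bound already lies in the interval; that matters only in \<open>R_unique\<close>.\<close>
  define R where "R x y \<longleftrightarrow> y \<in> S \<and> (x = y \<or> x = bot_el A \<and> y = p \<or> x = top_el A \<and> y = q)" for x y
  have S: "p \<in> S" "q \<in> S" using pq by (auto simp: S_def)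
  have SC: "x \<in> C" if "x \<in> S" for x using that by (simp add: S_def)
  have Scl: "x \<sqinter> y \<in> S" "x \<squnion> y \<in> S" if "x \<in> S" "y \<in> S" for x y
    using that pq by (simp_all add: S_def meet_le_trans le_join_trans)
  have Sb: "p \<sqinter> x = p" "q \<sqinter> x = x" "p \<squnion> x = x" "q \<squnion> x = q"
    "x \<sqinter> p = p" "x \<sqinter> q = x" "x \<squnion> p = x" "x \<squnion> q = q" if "x \<in> S" for x
  proof -
    have x: "x \<in> C" "p \<sqsubseteq> x" "x \<sqsubseteq> q" using that by (simp_all add: S_def)
    show *: "p \<sqinter> x = p" "x \<sqinter> q = x" "p \<squnion> x = x" "x \<squnion> q = q"
      using x pq by (simp_all add: lattice_le_def[symmetric] le_iff_join[symmetric])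
    show "x \<sqinter> p = p" "q \<sqinter> x = x" "x \<squnion> p = x" "q \<squnion> x = q"
      using * meet_commute[OF x(1)] join_commute[OF x(1)] pq by simp_all
  qed
  have R: "R (eval A v t) (eval ?B v t)" for t
  proof (induction t)
    case (Var n)
    then show ?case using v by (simp add: R_def S_def assignment_def)
  next
    case (Meet s t)
    then show ?case
      by (auto simp: R_def Scl SC Sb S)
  next
    case (Join s t)
    then show ?case
      by (auto simp: R_def Scl SC Sb S)
  qed (simp_all add: R_def S)
  \<comment> \<open>The next facts make \<open>R\<close> single-valued: the old bounds are distinct,
    and an old bound lying in the interval is already the corresponding new one.\<close>
  have bt: "bot_el A \<noteq> top_el A"
    using pq by (metis bounds_simps(3,5))
  have p_bot: "p = bot_el A" if "bot_el A \<in> S"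
    using Sb(7)[OF that] pq by simp
  have q_top: "q = top_el A" if "top_el A \<in> S"
    using Sb(6)[OF that] pq by simp
  have R_unique: "y = z" if "R x y" "R x z" for x y z
    using that bt p_bot q_top by (auto simp: R_def)
  have "assignment A v"
    using v by (simp add: assignment_def)
  then have "eval A v (fst e) = eval A v (snd e)"
    using e by (simp add: eq_valid_def satisfied_by_def)
  then show "satisfied_by ?B v e"
    using R_unique[OF R[of "fst e"], of "eval ?B v (snd e)"] R[of "snd e"]
    unfolding satisfied_by_def by simp
qed

end

section \<open>The diamond in a nondistributive modular lattice\<close>

locale modular_lat = bounded_lat +
  assumes modular: "x \<in> C \<Longrightarrow> y \<in> C \<Longrightarrow> z \<in> C \<Longrightarrow> x \<sqsubseteq> z \<Longrightarrow> x \<squnion> (y \<sqinter> z) = (x \<squnion> y) \<sqinter> z"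
begin

text \<open>The two medians coincide in distributive lattices. Here they become the bottom and top
  of the diamond.\<close>

definition lower_median where
  "lower_median a b c = (a \<sqinter> b) \<squnion> (b \<sqinter> c) \<squnion> (a \<sqinter> c)"

definition upper_median where
  "upper_median a b c = (a \<squnion> b) \<sqinter> (b \<squnion> c) \<sqinter> (a \<squnion> c)"

text \<open>This is \<open>a\<close> pushed into the interval between the medians: it equals
  \<open>(a \<sqinter> upper_median a b c) \<squnion> lower_median a b c\<close>, with absorbed
  terms left out.\<close>

definition diamond_atom where
  "diamond_atom a b c = (a \<sqinter> (b \<squnion> c)) \<squnion> (b \<sqinter> c)"

context
  fixes a b c
  assumes abc [simp]: "a \<in> C" "b \<in> C" "c \<in> C"
begin

text \<open>The modular law for \<open>b \<sqinter> c \<sqsubseteq> b \<squnion> c\<close>. The atom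
  is thus self-dual, and either form can be used: this one for meets, the defining one for
  joins.\<close>

lemma diamond_atom_alt: "diamond_atom a b c = (a \<squnion> (b \<sqinter> c)) \<sqinter> (b \<squnion> c)"
  unfolding diamond_atom_def
  by (subst join_commute, simp_all, subst modular) (simp_all add: join_commute meet_le_trans le_join_trans)

lemma diamond_atom_commute: "diamond_atom a c b = diamond_atom a b c"
  unfolding diamond_atom_def by (simp add: meet_commute[of b c] join_commute[of b c])

lemma median_commute:
  "lower_median b a c = lower_median a b c" "lower_median a c b = lower_median a b c"
  "upper_median b a c = upper_median a b c" "upper_median a c b = upper_median a b c"
  unfolding lower_median_def upper_median_def
  by (rule le_antisym; simp add: meet_le_trans le_join_trans)+

end

text \<open>In the alternative form, each of the factors \<open>b \<squnion> c\<close> and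
  \<open>a \<squnion> c\<close> lies above the first factor of the other atom and drops out. Two
  uses of the modular law expand the rest.\<close>

lemma diamond_meet:
  assumes [simp]: "a \<in> C" "b \<in> C" "c \<in> C"
  shows "diamond_atom a b c \<sqinter> diamond_atom b a c = lower_median a b c"
proof -
  have "diamond_atom a b c \<sqinter> diamond_atom b a c = (a \<squnion> (b \<sqinter> c)) \<sqinter> (b \<squnion> (a \<sqinter> c))"
    unfolding diamond_atom_alt[OF assms] diamond_atom_alt[OF assms(2,1,3)]
    by (rule le_antisym) (simp_all add: meet_le_trans le_join_trans)
  also have "\<dots> = (a \<sqinter> c) \<squnion> (b \<sqinter> (a \<squnion> (b \<sqinter> c)))"
    by (subst modular) (simp_all add: meet_le_trans le_join_trans meet_commute join_commute)
  also have "b \<sqinter> (a \<squnion> (b \<sqinter> c)) = (b \<sqinter> c) \<squnion> (a \<sqinter> b)"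
    by (subst modular) (simp_all add: meet_commute join_commute)
  also have "(a \<sqinter> c) \<squnion> \<dots> = lower_median a b c"
    unfolding lower_median_def by (rule le_antisym) (simp_all add: le_join_trans)
  finally show ?thesis .
qed

text \<open>The dual computation: the joined terms \<open>b \<sqinter> c\<close> and
  \<open>a \<sqinter> c\<close> are absorbed first, then the modular law is used twice.\<close>

lemma diamond_join:
  assumes [simp]: "a \<in> C" "b \<in> C" "c \<in> C"
  shows "diamond_atom a b c \<squnion> diamond_atom b a c = upper_median a b c"
proof -
  have "diamond_atom a b c \<squnion> diamond_atom b a c = (a \<sqinter> (b \<squnion> c)) \<squnion> (b \<sqinter> (a \<squnion> c))"
    unfolding diamond_atom_def
    by (rule le_antisym) (simp_all add: meet_le_trans le_join_trans)
  also have "\<dots> = ((a \<sqinter> (b \<squnion> c)) \<squnion> b) \<sqinter> (a \<squnion> c)"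
    by (subst modular) (simp_all add: meet_le_trans le_join_trans)
  also have "(a \<sqinter> (b \<squnion> c)) \<squnion> b = (b \<squnion> a) \<sqinter> (b \<squnion> c)"
    by (subst modular[symmetric]) (simp_all add: join_commute)
  also have "\<dots> \<sqinter> (a \<squnion> c) = upper_median a b c"
    unfolding upper_median_def by (simp add: join_commute)
  finally show ?thesis .
qed

lemma diamond_atom_closed [simp]:
  "a \<in> C \<Longrightarrow> b \<in> C \<Longrightarrow> c \<in> C \<Longrightarrow> diamond_atom a b c \<in> C"
  by (simp add: diamond_atom_def)

lemma median_closed [simp]:
  assumes "a \<in> C" "b \<in> C" "c \<in> C"
  shows "lower_median a b c \<in> C" "upper_median a b c \<in> C"
  using assms by (simp_all add: lower_median_def upper_median_def)

text \<open>Meeting the upper median with \<open>a\<close> gives the left side. Meeting the lower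
  one with \<open>a\<close> gives the right side, by modularity, as
  \<open>(a \<sqinter> b) \<squnion> (a \<sqinter> c) \<sqsubseteq> a\<close>.\<close>

lemma distributive_if_medians_eq:
  assumes [simp]: "a \<in> C" "b \<in> C" "c \<in> C"
    and eq: "lower_median a b c = upper_median a b c"
  shows "a \<sqinter> (b \<squnion> c) = (a \<sqinter> b) \<squnion> (a \<sqinter> c)"
proof -
  have "a \<sqinter> (b \<squnion> c) = upper_median a b c \<sqinter> a"
    unfolding upper_median_def
    by (rule le_antisym) (simp_all add: meet_le_trans le_join_trans)
  also have "upper_median a b c = (a \<sqinter> b) \<squnion> (a \<sqinter> c) \<squnion> (b \<sqinter> c)"
    unfolding eq[symmetric] lower_median_def
    by (rule le_antisym) (simp_all add: le_join_trans)
  also have "\<dots> \<sqinter> a = (a \<sqinter> b) \<squnion> (a \<sqinter> c) \<squnion> (b \<sqinter> c \<sqinter> a)"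
    by (subst modular) simp_all
  also have "\<dots> = (a \<sqinter> b) \<squnion> (a \<sqinter> c)"
    by (rule le_antisym) (simp_all add: meet_le_trans le_join_trans)
  finally show ?thesis .
qed

lemma nondistributive_obtains_diamond:
  assumes "\<not> distributive_bounded_lattice A"
  obtains p q x y z where "p \<in> C" "q \<in> C" "p \<noteq> q" "x \<in> C" "y \<in> C" "z \<in> C"
    "x \<sqinter> y = p" "x \<sqinter> z = p" "y \<sqinter> z = p" "x \<squnion> y = q" "x \<squnion> z = q" "y \<squnion> z = q"
proof -
  obtain a b c where abc: "a \<in> C" "b \<in> C" "c \<in> C"
    and "a \<sqinter> (b \<squnion> c) \<noteq> (a \<sqinter> b) \<squnion> (a \<sqinter> c)"
    using assms bounded_lattice by (auto simp: distributive_bounded_lattice_def)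
  then have "lower_median a b c \<noteq> upper_median a b c"
    using distributive_if_medians_eq by blast
  \<comment> \<open>The other two pairs of atoms reduce to the computed one by permuting the
    variables: the medians are symmetric, and an atom is symmetric in its last two
    arguments.\<close>
  moreover have "diamond_atom b a c \<sqinter> diamond_atom c a b = lower_median a b c"
    "diamond_atom b a c \<squnion> diamond_atom c a b = upper_median a b c"
    "diamond_atom a b c \<sqinter> diamond_atom c a b = lower_median a b c"
    "diamond_atom a b c \<squnion> diamond_atom c a b = upper_median a b c"
    using abc diamond_meet[of b c a] diamond_join[of b c a] diamond_meet[of a c b] diamond_join[of a c b]
    by (metis diamond_atom_commute median_commute)+
  ultimately show thesis
    using that[of "lower_median a b c" "upper_median a b c"
        "diamond_atom a b c" "diamond_atom b a c" "diamond_atom c a b"]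
      abc diamond_meet diamond_join by simp
qed

end

section \<open>Prime filters of distributive lattices\<close>

locale distributive_lat = bounded_lat +
  assumes distributive:
    "x \<in> C \<Longrightarrow> y \<in> C \<Longrightarrow> z \<in> C \<Longrightarrow> x \<sqinter> (y \<squnion> z) = (x \<sqinter> y) \<squnion> (x \<sqinter> z)"
begin

definition lattice_filter where
  "lattice_filter F \<longleftrightarrow> F \<subseteq> C \<and> F \<noteq> {} \<and> (\<forall>x\<in>F. \<forall>y\<in>F. x \<sqinter> y \<in> F) \<and>
     (\<forall>x\<in>F. \<forall>y\<in>C. x \<sqsubseteq> y \<longrightarrow> y \<in> F)"

lemma lattice_filterD:
  assumes "lattice_filter F" "x \<in> F"
  shows "x \<in> C" "y \<in> F \<Longrightarrow> x \<sqinter> y \<in> F" "y \<in> C \<Longrightarrow> x \<sqsubseteq> y \<Longrightarrow> y \<in> F"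
  using assms unfolding lattice_filter_def by blast+

text \<open>\<open>G\<close> is the filter generated by \<open>F\<close> and \<open>x\<close>; its
  explicit form turns \<open>b \<in> G\<close> into an inequality
  \<open>u \<sqinter> x \<sqsubseteq> b\<close>.\<close>

lemma lattice_filter_adjoin:
  assumes F: "lattice_filter F" and x: "x \<in> C"
  defines "G \<equiv> {z \<in> C. \<exists>u\<in>F. u \<sqinter> x \<sqsubseteq> z}"
  shows "lattice_filter G" "F \<subseteq> G" "x \<in> G"
proof -
  have FC: "u \<in> C" if "u \<in> F" for u using that F by (auto simp: lattice_filter_def)
  show "F \<subseteq> G" using x FC by (force simp: G_def)
  obtain u where u: "u \<in> F" using F by (auto simp: lattice_filter_def)
  then show "x \<in> G" using x FC meet_le(2) unfolding G_def by blast
  have "y \<sqinter> z \<in> G" if yz: "y \<in> G" "z \<in> G" for y z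
  proof -
    from yz obtain u u' where u: "u \<in> F" "u \<sqinter> x \<sqsubseteq> y" "u' \<in> F" "u' \<sqinter> x \<sqsubseteq> z" "y \<in> C" "z \<in> C"
      by (auto simp: G_def)
    then have "u \<sqinter> u' \<sqinter> x \<sqsubseteq> u \<sqinter> x" "u \<sqinter> u' \<sqinter> x \<sqsubseteq> u' \<sqinter> x"
      using x FC by (simp_all add: meet_le_trans)
    then have "u \<sqinter> u' \<sqinter> x \<sqsubseteq> y \<sqinter> z"
      using u x FC le_trans[of "u \<sqinter> u' \<sqinter> x" "u \<sqinter> x" y] le_trans[of "u \<sqinter> u' \<sqinter> x" "u' \<sqinter> x" z]
      by simp
    moreover have "u \<sqinter> u' \<in> F" using u F by (simp add: lattice_filter_def)
    ultimately show ?thesis using u by (auto simp: G_def)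
  qed
  moreover have "z \<in> G" if "y \<in> G" "z \<in> C" "y \<sqsubseteq> z" for y z
  proof -
    from that obtain u where u: "u \<in> F" "u \<sqinter> x \<sqsubseteq> y" "y \<in> C" by (auto simp: G_def)
    then have "u \<sqinter> x \<sqsubseteq> z" using that x FC le_trans[of "u \<sqinter> x" y z] by simp
    then show ?thesis using u that by (auto simp: G_def)
  qed
  ultimately show "lattice_filter G"
    using \<open>x \<in> G\<close> by (auto simp: lattice_filter_def G_def)
qed

text \<open>Zorn's lemma gives a filter maximal among those containing \<open>a\<close> and omitting
  \<open>b\<close>; distributivity makes it prime.\<close>

lemma obtains_prime_filter:
  assumes ab: "a \<in> C" "b \<in> C" "\<not> a \<sqsubseteq> b"
  obtains F where "lattice_filter F" "a \<in> F" "b \<notin> F"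
    "\<And>x y. x \<in> C \<Longrightarrow> y \<in> C \<Longrightarrow> x \<squnion> y \<in> F \<Longrightarrow> x \<in> F \<or> y \<in> F"
proof -
  let ?\<F> = "{F. lattice_filter F \<and> a \<in> F \<and> b \<notin> F}"
  \<comment> \<open>The principal filter of \<open>a\<close> omits \<open>b\<close> because
    \<open>a\<close> is not below \<open>b\<close>.\<close>
  have "{x \<in> C. a \<sqsubseteq> x} \<in> ?\<F>"
    using ab by (auto simp: lattice_filter_def intro: le_trans)
  then have "?\<F> \<noteq> {}" by blast
  moreover have "\<Union>K \<in> ?\<F>" if K: "K \<noteq> {}" "subset.chain ?\<F> K" for K
  proof -
    have tot: "X \<subseteq> Y \<or> Y \<subseteq> X" if "X \<in> K" "Y \<in> K" for X Y
      using K that by (auto simp: subset_chain_def)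
    have KF: "F \<in> ?\<F>" if "F \<in> K" for F
      using K that by (auto simp: subset_chain_def)
    have "x \<sqinter> y \<in> \<Union>K" if xy: "x \<in> \<Union>K" "y \<in> \<Union>K" for x y
    proof -
      from xy obtain X Y where XY: "X \<in> K" "x \<in> X" "Y \<in> K" "y \<in> Y" by blast
      then obtain Z where Z: "Z \<in> K" "x \<in> Z" "y \<in> Z" using tot[of X Y] by blast
      then have "x \<sqinter> y \<in> Z" using KF[OF Z(1)] by (simp add: lattice_filter_def)
      then show ?thesis using Z by blast
    qed
    moreover have "y \<in> \<Union>K" if "x \<in> \<Union>K" "y \<in> C" "x \<sqsubseteq> y" for x y
    proof -
      from that obtain X where X: "X \<in> K" "x \<in> X" by blast
      then have "y \<in> X" using that KF[OF X(1)] unfolding lattice_filter_def by blast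
      then show ?thesis using X by blast
    qed
    moreover have "a \<in> \<Union>K" "b \<notin> \<Union>K" "\<Union>K \<subseteq> C"
      using K(1) KF unfolding lattice_filter_def by blast+
    ultimately show ?thesis unfolding lattice_filter_def by blast
  qed
  ultimately obtain F where F: "lattice_filter F" "a \<in> F" "b \<notin> F"
    and max: "\<And>G. lattice_filter G \<Longrightarrow> a \<in> G \<Longrightarrow> b \<notin> G \<Longrightarrow> F \<subseteq> G \<Longrightarrow> G = F"
    using subset_Zorn_nonempty[of ?\<F>] by blast
  have FC: "u \<in> C" if "u \<in> F" for u using that F by (auto simp: lattice_filter_def)
  \<comment> \<open>By maximality, the filter generated by \<open>F\<close> and an outside element
    must contain \<open>b\<close>.\<close>
  have below_b: "\<exists>u\<in>F. u \<sqinter> x \<sqsubseteq> b" if "x \<in> C" "x \<notin> F" for x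
  proof (rule ccontr)
    assume "\<not> ?thesis"
    then show False
      using lattice_filter_adjoin[OF F(1) \<open>x \<in> C\<close>] max[of "{z \<in> C. \<exists>u\<in>F. u \<sqinter> x \<sqsubseteq> z}"] F that
      by blast
  qed
  have "x \<in> F \<or> y \<in> F" if xy: "x \<in> C" "y \<in> C" "x \<squnion> y \<in> F" for x y
  proof (rule ccontr)
    assume "\<not> ?thesis"
    then obtain u u' where u: "u \<in> F" "u \<sqinter> x \<sqsubseteq> b" "u' \<in> F" "u' \<sqinter> y \<sqsubseteq> b"
      using below_b xy by meson
    \<comment> \<open>A single witness for both inequalities, so that distributivity puts
      \<open>w \<sqinter> (x \<squnion> y)\<close>, a member of \<open>F\<close>, below
      \<open>b\<close>.\<close>
    define w where "w = u \<sqinter> u'"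
    have w: "w \<in> F" "w \<in> C" using u FC lattice_filterD(2)[OF F(1)] by (simp_all add: w_def)
    have "w \<sqinter> x \<sqsubseteq> u \<sqinter> x" "w \<sqinter> y \<sqsubseteq> u' \<sqinter> y"
      using u xy FC by (simp_all add: w_def meet_le_trans)
    then have "w \<sqinter> x \<sqsubseteq> b" "w \<sqinter> y \<sqsubseteq> b"
      using u xy FC w ab le_trans[of "w \<sqinter> x" "u \<sqinter> x" b] le_trans[of "w \<sqinter> y" "u' \<sqinter> y" b] by auto
    then have "w \<sqinter> (x \<squnion> y) \<sqsubseteq> b"
      using w xy ab by (simp add: distributive)
    moreover have "w \<sqinter> (x \<squnion> y) \<in> F" using w xy lattice_filterD(2)[OF F(1)] by simp
    ultimately show False using F ab lattice_filterD(3) by blast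
  qed
  then show thesis using that F by blast
qed

end

section \<open>Unifiability and two-valued solutions\<close>

primrec beval :: "(nat \<Rightarrow> bool) \<Rightarrow> bl_term \<Rightarrow> bool" where
  "beval w (Var n) = w n"
| "beval w Bot = False"
| "beval w Top = True"
| "beval w (Meet s t) = (beval w s \<and> beval w t)"
| "beval w (Join s t) = (beval w s \<or> beval w t)"

definition solves :: "(nat \<Rightarrow> bool) \<Rightarrow> equation \<Rightarrow> bool" where
  "solves w e \<longleftrightarrow> beval w (fst e) = beval w (snd e)"

text \<open>Membership in a prime filter is a homomorphism onto the two-element lattice: it
  preserves every equation satisfied under \<open>v\<close>, and the filter is chosen to separate
  the values of \<open>s\<close> and \<open>t\<close>.\<close>

lemma (in distributive_lat) obtains_separating_valuation:
  assumes v: "assignment A v" and st: "eval A v s \<noteq> eval A v t"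
  obtains w where "\<And>e. satisfied_by A v e \<Longrightarrow> solves w e" "\<not> solves w (s, t)"
proof -
  have *: "\<exists>w. (\<forall>e. satisfied_by A v e \<longrightarrow> solves w e) \<and> \<not> solves w (s, t)"
    if nle: "\<not> eval A v s \<sqsubseteq> eval A v t" for s t
  proof -
    obtain F where F: "lattice_filter F" "eval A v s \<in> F" "eval A v t \<notin> F"
      and prime: "\<And>x y. x \<in> C \<Longrightarrow> y \<in> C \<Longrightarrow> x \<squnion> y \<in> F \<Longrightarrow> x \<in> F \<or> y \<in> F"
      using obtains_prime_filter[OF eval_closed[OF v] eval_closed[OF v] nle] by blast
    have up: "x \<in> F \<Longrightarrow> y \<in> C \<Longrightarrow> x \<sqsubseteq> y \<Longrightarrow> y \<in> F" for x y
      using F lattice_filterD(3) by blast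
    \<comment> \<open>\<open>F\<close> is proper because it omits the value of \<open>t\<close>, and
      it contains the top because it contains the value of \<open>s\<close>.\<close>
    have "bot_el A \<notin> F" "top_el A \<in> F"
      using F v up[of "bot_el A" "eval A v t"] up[of "eval A v s" "top_el A"]
      by (auto simp: lattice_le_def)
    moreover have "x \<sqinter> y \<in> F \<longleftrightarrow> x \<in> F \<and> y \<in> F" if "x \<in> C" "y \<in> C" for x y
      using that up[of "x \<sqinter> y"] lattice_filterD(2)[OF F(1)] meet_le[of x y] by blast
    moreover have "x \<squnion> y \<in> F \<longleftrightarrow> x \<in> F \<or> y \<in> F" if "x \<in> C" "y \<in> C" for x y
      using that prime[of x y] up le_join by blast
    ultimately have "beval (\<lambda>n. v n \<in> F) r \<longleftrightarrow> eval A v r \<in> F" for r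
      using v by (induction r) auto
    then show ?thesis
      using F by (intro exI[of _ "\<lambda>n. v n \<in> F"]) (simp add: solves_def satisfied_by_def)
  qed
  have "\<not> eval A v s \<sqsubseteq> eval A v t \<or> \<not> eval A v t \<sqsubseteq> eval A v s"
    using st v le_antisym by auto
  moreover have "solves w (t, s) \<longleftrightarrow> solves w (s, t)" for w
    by (auto simp: solves_def)
  ultimately show thesis
    using *[of s t] *[of t s] that by blast
qed

text \<open>On the two bounds, meet and join act as conjunction and disjunction of truth
  values.\<close>

lemma (in bounded_lat) eval_two_valued:
  assumes "\<And>n. v n = (if w n then top_el A else bot_el A)"
  shows "eval A v t = (if beval w t then top_el A else bot_el A)"
  by (induction t) (simp_all add: assms)

lemma (in bounded_lat) bot_neq_top:
  assumes "x \<in> C" "y \<in> C" "x \<noteq> y"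
  shows "bot_el A \<noteq> top_el A"
  using assms by (metis bounds_simps(3,5))

lemma (in bounded_lat) satisfied_by_two_valued:
  assumes "bot_el A \<noteq> top_el A" "\<And>n. v n = (if w n then top_el A else bot_el A)"
  shows "satisfied_by A v e \<longleftrightarrow> solves w e"
  using assms(1) by (auto simp: satisfied_by_def solves_def eval_two_valued[OF assms(2)])

section \<open>Substitutions into the free algebra and unifiability\<close>

lemma equiv_identities: "equiv UNIV (identities Q)"
  by (rule equivI)
    (auto simp: refl_on_def sym_def trans_def identities_def eq_valid_def satisfied_by_def)

lemma free_algebra_meet:
  "meet (free_algebra Q) (identities Q `` {s}) (identities Q `` {t}) = identities Q `` {Meet s t}"
  unfolding free_algebra_def bl_algebra.simps
  by (rule UN_equiv_class2[OF equiv_identities equiv_identities])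
    (auto simp: congruent2_def identities_def eq_valid_def satisfied_by_def
      intro!: equiv_class_eq[OF equiv_identities])

lemma free_algebra_join:
  "join (free_algebra Q) (identities Q `` {s}) (identities Q `` {t}) = identities Q `` {Join s t}"
  unfolding free_algebra_def bl_algebra.simps
  by (rule UN_equiv_class2[OF equiv_identities equiv_identities])
    (auto simp: congruent2_def identities_def eq_valid_def satisfied_by_def
      intro!: equiv_class_eq[OF equiv_identities])

primrec subst :: "(nat \<Rightarrow> bl_term) \<Rightarrow> bl_term \<Rightarrow> bl_term" where
  "subst \<theta> (Var n) = \<theta> n"
| "subst \<theta> Bot = Bot"
| "subst \<theta> Top = Top"
| "subst \<theta> (Meet s t) = Meet (subst \<theta> s) (subst \<theta> t)"
| "subst \<theta> (Join s t) = Join (subst \<theta> s) (subst \<theta> t)"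

lemma eval_subst: "eval A v (subst \<theta> t) = eval A (\<lambda>n. eval A v (\<theta> n)) t"
  by (induction t) simp_all

text \<open>A homomorphism on terms is determined by its values on the variables. Choosing a
  representative term \<open>\<theta> n\<close> of each value lifts it to a substitution of
  terms.\<close>

lemma substitution_iff:
  "substitution Q \<sigma> \<longleftrightarrow> (\<exists>\<theta>. \<sigma> = (\<lambda>t. identities Q `` {subst \<theta> t}))"
proof
  assume \<sigma>: "substitution Q \<sigma>"
  have "\<sigma> (Var n) \<in> UNIV // identities Q" for n
    using \<sigma> by (simp add: substitution_def homomorphism_def term_algebra_def free_algebra_def)
  then have "\<exists>t. \<sigma> (Var n) = identities Q `` {t}" for n
    by (auto elim!: quotientE)
  then obtain \<theta> where \<theta>: "\<And>n. \<sigma> (Var n) = identities Q `` {\<theta> n}"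
    by metis
  have hom: "\<sigma> Bot = identities Q `` {Bot}" "\<sigma> Top = identities Q `` {Top}"
    "\<sigma> (Meet s t) = meet (free_algebra Q) (\<sigma> s) (\<sigma> t)"
    "\<sigma> (Join s t) = join (free_algebra Q) (\<sigma> s) (\<sigma> t)" for s t
    using \<sigma> by (simp_all add: substitution_def homomorphism_def term_algebra_def,
      simp_all add: free_algebra_def)
  have "\<sigma> t = identities Q `` {subst \<theta> t}" for t
    by (induction t) (simp_all add: \<theta> hom free_algebra_meet free_algebra_join)
  then show "\<exists>\<theta>. \<sigma> = (\<lambda>t. identities Q `` {subst \<theta> t})" by blast
next
  assume "\<exists>\<theta>. \<sigma> = (\<lambda>t. identities Q `` {subst \<theta> t})"
  then show "substitution Q \<sigma>"
    by (auto simp: substitution_def homomorphism_def term_algebra_def free_algebra_meet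
        free_algebra_join) (auto simp: free_algebra_def quotientI)
qed

lemma unifiable_iff:
  assumes lat: "\<forall>A\<in>Q. bounded_lattice_algebra A" and nt: "nontrivial Q"
  shows "(\<exists>\<sigma>. substitution Q \<sigma> \<and> unifies \<sigma> \<Sigma>) \<longleftrightarrow> (\<exists>w. \<forall>e\<in>\<Sigma>. solves w e)"
proof
  assume "\<exists>\<sigma>. substitution Q \<sigma> \<and> unifies \<sigma> \<Sigma>"
  then obtain \<theta> where \<theta>: "\<forall>(s, t)\<in>\<Sigma>. identities Q `` {subst \<theta> s} = identities Q `` {subst \<theta> t}"
    by (auto simp: substitution_iff unifies_def)
  then have \<theta>: "(subst \<theta> s, subst \<theta> t) \<in> identities Q" if "(s, t) \<in> \<Sigma>" for s t
    using that eq_equiv_class[OF _ equiv_identities] by blast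
  obtain A x y where A: "A \<in> Q" and xy: "x \<in> carrier A" "y \<in> carrier A" "x \<noteq> y"
    using nt by (auto simp: nontrivial_def)
  interpret bounded_lat A using lat A by unfold_locales blast
  \<comment> \<open>The unifying terms evaluated with all variables at bottom: their values are
    bounds, and nontriviality of \<open>A\<close> lets truth values be read off from them.\<close>
  define v where "v n = eval A (\<lambda>_. bot_el A) (\<theta> n)" for n
  have v: "v n = (if beval (\<lambda>_. False) (\<theta> n) then top_el A else bot_el A)" for n
    unfolding v_def by (rule eval_two_valued) simp
  have "assignment A (\<lambda>_. bot_el A)" by (simp add: assignment_def)
  then have "satisfied_by A v e" if "e \<in> \<Sigma>" for e
    using \<theta>[of "fst e" "snd e"] that A
    unfolding identities_def eq_valid_def satisfied_by_def v_def by (simp add: eval_subst)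
  then have "\<forall>e\<in>\<Sigma>. solves (\<lambda>n. beval (\<lambda>_. False) (\<theta> n)) e"
    by (simp add: satisfied_by_two_valued[OF bot_neq_top[OF xy] v])
  then show "\<exists>w. \<forall>e\<in>\<Sigma>. solves w e"
    by (rule exI[where x = "\<lambda>n. beval (\<lambda>_. False) (\<theta> n)"])
next
  assume "\<exists>w. \<forall>e\<in>\<Sigma>. solves w e"
  then obtain w where w: "\<And>e. e \<in> \<Sigma> \<Longrightarrow> solves w e" by blast
  \<comment> \<open>A two-valued solution becomes a substitution by constants, which unifies in
    every bounded lattice.\<close>
  let ?\<theta> = "\<lambda>n. if w n then Top else Bot"
  have "(subst ?\<theta> s, subst ?\<theta> t) \<in> identities Q" if "(s, t) \<in> \<Sigma>" for s t
    unfolding identities_def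
  proof (intro CollectI ballI)
    fix A assume "A \<in> Q"
    then interpret bounded_lat A using lat by unfold_locales blast
    have "eval A v (subst ?\<theta> r) = (if beval w r then top_el A else bot_el A)" for v r
      unfolding eval_subst by (rule eval_two_valued) simp
    then show "eq_valid A (subst ?\<theta> s, subst ?\<theta> t)"
      using w[OF that] by (simp add: eq_valid_def satisfied_by_def solves_def)
  qed
  then have "unifies (\<lambda>t. identities Q `` {subst ?\<theta> t}) \<Sigma>"
    using equiv_class_eq[OF equiv_identities] by (fastforce simp: unifies_def)
  then show "\<exists>\<sigma>. substitution Q \<sigma> \<and> unifies \<sigma> \<Sigma>"
    using substitution_iff by blast
qed

section \<open>Passive structural completeness and distributivity\<close>

lemma distributive_latI: "distributive_bounded_lattice A \<Longrightarrow> distributive_lat A"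
  by unfold_locales (auto simp: distributive_bounded_lattice_def)

lemma modular_latI: "modular_bounded_lattice A \<Longrightarrow> modular_lat A"
  by unfold_locales (auto simp: modular_bounded_lattice_def)

text \<open>A failure of \<open>\<delta>\<close> under \<open>v\<close> yields a separating
  valuation. It solves \<open>\<Sigma>\<close>, so \<open>\<Sigma>\<close> has a unifier, against
  passivity.\<close>

lemma passive_structurally_complete_distributive:
  fixes V :: "'a bl_algebra set"
  assumes V: "\<forall>A\<in>V. distributive_bounded_lattice A" and nt: "nontrivial V"
  shows "passive_structurally_complete V"
  unfolding passive_structurally_complete_def quasieq_valid_def
proof (intro allI impI ballI)
  fix \<Sigma> \<delta> A and v :: "nat \<Rightarrow> 'a"
  assume pas: "passive_quasieq V \<Sigma> \<delta>" and A: "A \<in> V" and v: "assignment A v"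
    and \<Sigma>: "\<forall>e\<in>\<Sigma>. satisfied_by A v e"
  interpret distributive_lat A using V A distributive_latI by blast
  have "\<forall>A\<in>V. bounded_lattice_algebra A"
    using V by (simp add: distributive_bounded_lattice_def)
  then have "\<nexists>w. \<forall>e\<in>\<Sigma>. solves w e"
    using pas unifiable_iff[OF _ nt] by (auto simp: passive_quasieq_def)
  moreover have "\<exists>w. \<forall>e\<in>\<Sigma>. solves w e" if "eval A v (fst \<delta>) \<noteq> eval A v (snd \<delta>)"
    by (rule obtains_separating_valuation[OF v that]) (use \<Sigma> in blast)
  ultimately show "satisfied_by A v \<delta>"
    by (auto simp: satisfied_by_def)
qed

text \<open>The defining equations of \<open>V\<close> hold at the bounds of a nontrivial member,
  hence under all two-valued valuations. An equation failing in \<open>B\<close> would fail under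
  one of these.\<close>

lemma distributive_in_nontrivial_variety:
  assumes "variety V" and lat: "\<forall>A\<in>V. bounded_lattice_algebra A" and nt: "nontrivial V"
    and B: "distributive_bounded_lattice B"
  shows "B \<in> V"
proof -
  obtain E where E: "V = {A. algebra A \<and> (\<forall>e\<in>E. eq_valid A e)}"
    using \<open>variety V\<close> by (auto simp: variety_def)
  obtain A x y where A: "A \<in> V" and xy: "x \<in> carrier A" "y \<in> carrier A" "x \<noteq> y"
    using nt by (auto simp: nontrivial_def)
  interpret A: bounded_lat A using lat A by unfold_locales blast
  have sol: "solves w e" if "e \<in> E" for w e
  proof -
    let ?v = "\<lambda>n. if w n then top_el A else bot_el A"
    have "assignment A ?v" by (simp add: assignment_def)
    then have "satisfied_by A ?v e" using A that by (simp add: E eq_valid_def)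
    then show ?thesis by (simp add: A.satisfied_by_two_valued[OF A.bot_neq_top[OF xy]])
  qed
  interpret B: distributive_lat B using B by (rule distributive_latI)
  have "eq_valid B e" if "e \<in> E" for e
    unfolding eq_valid_def
  proof (intro allI impI)
    fix v assume "assignment B v"
    then have False if "eval B v (fst e) \<noteq> eval B v (snd e)"
      by (rule B.obtains_separating_valuation[OF _ that]) (use sol[OF \<open>e \<in> E\<close>] in simp)
    then show "satisfied_by B v e"
      by (auto simp: satisfied_by_def)
  qed
  moreover have "algebra B"
    using B by (simp add: distributive_bounded_lattice_def bounded_lattice_algebra_def)
  ultimately show ?thesis by (simp add: E)
qed

text \<open>The diamond with its bounds as constants. Two of any three truth values coincide, and no
  truth value is its own complement, so there is no two-valued solution.\<close>

definition pairwise_complements :: "equation set" where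
  "pairwise_complements = (let x = Var 0; y = Var 1; z = Var 2 in
     {(Meet x y, Bot), (Meet x z, Bot), (Meet y z, Bot),
      (Join x y, Top), (Join x z, Top), (Join y z, Top)})"

lemma distributive_if_passive_structurally_complete:
  assumes "variety V" and mod: "\<forall>A\<in>V. modular_bounded_lattice A" and nt: "nontrivial V"
    and psc: "passive_structurally_complete V" and A: "A \<in> V"
  shows "distributive_bounded_lattice A"
proof (rule ccontr)
  assume nd: "\<not> distributive_bounded_lattice A"
  interpret modular_lat A using mod A modular_latI by blast
  obtain E where E: "V = {A. algebra A \<and> (\<forall>e\<in>E. eq_valid A e)}"
    using \<open>variety V\<close> by (auto simp: variety_def)
  have lat: "\<forall>A\<in>V. bounded_lattice_algebra A"
    using mod by (simp add: modular_bounded_lattice_def)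
  obtain p q x y z where pq: "p \<in> C" "q \<in> C" "p \<noteq> q" and xyz: "x \<in> C" "y \<in> C" "z \<in> C"
    and eqs: "x \<sqinter> y = p" "x \<sqinter> z = p" "y \<sqinter> z = p" "x \<squnion> y = q" "x \<squnion> z = q" "y \<squnion> z = q"
    using nondistributive_obtains_diamond[OF nd] by metis
  have le: "p \<sqsubseteq> x" "p \<sqsubseteq> y" "p \<sqsubseteq> z" "x \<sqsubseteq> q" "y \<sqsubseteq> q" "z \<sqsubseteq> q"
    using meet_le[OF xyz(1,2)] meet_le[OF xyz(2,3)] le_join[OF xyz(1,2)] le_join[OF xyz(2,3)]
    by (simp_all add: eqs)
  then have "p \<sqsubseteq> q" using le_trans pq xyz by blast
  let ?B = "A\<lparr>carrier := {x \<in> C. p \<sqsubseteq> x \<and> x \<sqsubseteq> q}, bot_el := p, top_el := q\<rparr>"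
  have "\<forall>e\<in>E. eq_valid ?B e"
    using A eq_valid_interval[OF pq(1,2) \<open>p \<sqsubseteq> q\<close> pq(3)] by (simp add: E)
  moreover have "algebra ?B"
    using pq \<open>p \<sqsubseteq> q\<close> by (auto simp: algebra_def intro: meet_le_trans le_join_trans)
  ultimately have "?B \<in> V" by (simp add: E)
  have "\<nexists>w. \<forall>e\<in>pairwise_complements. solves w e"
    by (auto simp: pairwise_complements_def Let_def solves_def)
  then have unsat: "\<not> (\<exists>\<sigma>. substitution V \<sigma> \<and> unifies \<sigma> pairwise_complements)"
    using unifiable_iff[OF lat nt] by blast
  \<comment> \<open>Without a unifier of the premises, every conclusion gives a passive and
    vacuously admissible quasiequation. \<open>Bot = Top\<close> is chosen because it fails whenever
    the bounds differ.\<close>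
  then have "quasieq_valid V pairwise_complements (Bot, Top)"
    using psc unfolding passive_structurally_complete_def passive_quasieq_def admissible_quasieq_def
    by (auto simp: pairwise_complements_def Let_def)
  \<comment> \<open>Only the first three variables occur in the equations; the remaining ones take
    the default \<open>z\<close>, which keeps \<open>v\<close> inside the interval.\<close>
  moreover define v where "v n = (if n = 0 then x else if n = 1 then y else z)" for n :: nat
  moreover have "assignment ?B v"
    using xyz le by (simp add: assignment_def v_def)
  moreover have "\<forall>e\<in>pairwise_complements. satisfied_by ?B v e"
    using eqs by (simp add: pairwise_complements_def Let_def satisfied_by_def v_def)
  ultimately have "satisfied_by ?B v (Bot, Top)"
    using \<open>?B \<in> V\<close> unfolding quasieq_valid_def by blast
  then show False using pq by (simp add: satisfied_by_def)
qed

text \<open>Nontriviality excludes the variety of one-element lattices: there every set of equations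
  is unifiable, so passive structural completeness holds vacuously.\<close>

theorem theorem5p8:
  fixes V :: "'a bl_algebra set"
  assumes "infinite (UNIV :: 'a set)"
    and "variety V"
    and "\<forall>A\<in>V. modular_bounded_lattice A"
    and "nontrivial V"
  shows "passive_structurally_complete V \<longleftrightarrow> V = {A. distributive_bounded_lattice A}"
proof
  assume "passive_structurally_complete V"
  moreover have "\<forall>A\<in>V. bounded_lattice_algebra A"
    using assms(3) by (simp add: modular_bounded_lattice_def)
  ultimately show "V = {A. distributive_bounded_lattice A}"
    using distributive_in_nontrivial_variety distributive_if_passive_structurally_complete assms
    by blast
next
  assume "V = {A. distributive_bounded_lattice A}"
  then show "passive_structurally_complete V"
    using passive_structurally_complete_distributive assms by blast
qed

end
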